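(* Let $A\colon L^\infty(\Omega,\mu)\to L^1(\Omega,\mu)$ be a linear operator, where $(\Omega,\mu)$ is an atomless separable finite measure space. Then there is a $\mu$-filter $\mathcal{F}$ such that any ultrafilter $\mathcal{U}$ containing $\mathcal{F}$ has the following property: for all $f\in B_1^{L^\infty}$, $\varepsilon>0$ and $a\in[-1,1]$, there is $f_{a,\varepsilon}\in B_1^{L^\infty}$ such that (I) $\|f-f_{a,\varepsilon}\|_1<\varepsilon$; (II) $\|Af-Af_{a,\varepsilon}\|_1<\varepsilon$; (III) $\phi_\mathcal{U}(f_{a,\varepsilon})\in(a-\varepsilon,a+\varepsilon)$.
   Context: $B_1^{L^\infty}$ is the closed unit ball of $L^\infty(\Omega,\mu)$. A $\mu$-filter is a nonempty collection $\mathcal{F}$ of measurable subsets of $\Omega$ such that $\mu(S)>0$ for all $S\in\mathcal{F}$, $S,T\in\mathcal{F}\Rightarrow S\cap T\in\mathcal{F}$, and $S\in\mathcal{F}$, $S\subset T$ measurable $\Rightarrow T\in\mathcal{F}$; an ultrafilter is a maximal $\mu$-filter. For an ultrafilter $\mathcal{U}$, $\phi_\mathcal{U}\colon L^\infty(\Omega,\mu)\to\mathbb{R}$ sends $f=\lim_n\sum_{i=1}^n\alpha_{n,i}\chi_{E_{n,i}}$ (limit of simple functions in $L^\infty$-norm) to $\lim_n\sum_{i=1}^n\alpha_{n,i}\mathds{1}_{E_{n,i}\in\mathcal{U}}$, i.e. integration against the finitely additive measure $\delta_\mathcal{U}(E)=1$ if $E\in\mathcal{U}$, $0$ otherwise.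 *)

theory Defs
  imports "HOL-Probability.Essential_Supremum"
begin

text \<open>
  Elements of the real spaces \<open>L\<^sup>\<infinity>\<close> and \<open>L\<^sup>1\<close> are represented by measurable functions;
  two functions represent the same element iff they agree almost everywhere.
\<close>

definition Linf_norm :: "'a measure \<Rightarrow> ('a \<Rightarrow> real) \<Rightarrow> ereal" where
  "Linf_norm M f = esssup M (\<lambda>x. ereal \<bar>f x\<bar>)"

definition Linf :: "'a measure \<Rightarrow> ('a \<Rightarrow> real) set" where
  "Linf M = {f \<in> borel_measurable M. Linf_norm M f < \<infinity>}"

definition Linf_unit_ball :: "'a measure \<Rightarrow> ('a \<Rightarrow> real) set" where
  "Linf_unit_ball M = {f \<in> Linf M. Linf_norm M f \<le> 1}"

definition L1_norm :: "'a measure \<Rightarrow> ('a \<Rightarrow> real) \<Rightarrow> real" where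
  "L1_norm M f = (LINT x|M. \<bar>f x\<bar>)"

text \<open>
  Linear maps from \<open>L\<^sup>\<infinity>\<close> to \<open>L\<^sup>1\<close>, acting on representatives. The second conjunct says that
  the map is well defined on classes modulo almost everywhere equality. No continuity is required.
\<close>

definition linear_Linf_L1 :: "'a measure \<Rightarrow> (('a \<Rightarrow> real) \<Rightarrow> ('a \<Rightarrow> real)) \<Rightarrow> bool" where
  "linear_Linf_L1 M A \<longleftrightarrow>
     (\<forall>f\<in>Linf M. integrable M (A f)) \<and>
     (\<forall>f\<in>Linf M. \<forall>g\<in>Linf M. (AE x in M. f x = g x) \<longrightarrow> (AE x in M. A f x = A g x)) \<and>
     (\<forall>f\<in>Linf M. \<forall>g\<in>Linf M. AE x in M. A (\<lambda>y. f y + g y) x = A f x + A g x) \<and>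
     (\<forall>c. \<forall>f\<in>Linf M. AE x in M. A (\<lambda>y. c * f y) x = c * A f x)"

definition measure_atom :: "'a measure \<Rightarrow> 'a set \<Rightarrow> bool" where
  "measure_atom M S \<longleftrightarrow> S \<in> sets M \<and> emeasure M S > 0 \<and>
     (\<forall>T\<in>sets M. T \<subseteq> S \<longrightarrow> emeasure M T = 0 \<or> emeasure M T = emeasure M S)"

definition atomless :: "'a measure \<Rightarrow> bool" where
  "atomless M \<longleftrightarrow> (\<nexists>S. measure_atom M S)"

text \<open>
  Separability of the measure algebra for the pseudometric given by the measure of the
  symmetric difference (meant for finite measures).
\<close>

definition separable_measure :: "'a measure \<Rightarrow> bool" where
  "separable_measure M \<longleftrightarrow>
     (\<exists>D. countable D \<and> D \<subseteq> sets M \<and>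
        (\<forall>S\<in>sets M. \<forall>e>0. \<exists>T\<in>D. measure M ((S - T) \<union> (T - S)) < e))"

definition mu_filter :: "'a measure \<Rightarrow> 'a set set \<Rightarrow> bool" where
  "mu_filter M F \<longleftrightarrow> F \<noteq> {} \<and> F \<subseteq> sets M \<and>
     (\<forall>S\<in>F. emeasure M S > 0) \<and>
     (\<forall>S\<in>F. \<forall>T\<in>F. S \<inter> T \<in> F) \<and>
     (\<forall>S\<in>F. \<forall>T\<in>sets M. S \<subseteq> T \<longrightarrow> T \<in> F)"

definition mu_ultrafilter :: "'a measure \<Rightarrow> 'a set set \<Rightarrow> bool" where
  "mu_ultrafilter M U \<longleftrightarrow> mu_filter M U \<and> (\<forall>G. mu_filter M G \<and> U \<subseteq> G \<longrightarrow> G = U)"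

definition delta_U :: "'a set set \<Rightarrow> 'a set \<Rightarrow> real" where
  "delta_U U E = (if E \<in> U then 1 else 0)"

definition is_phi_value :: "'a measure \<Rightarrow> 'a set set \<Rightarrow> ('a \<Rightarrow> real) \<Rightarrow> real \<Rightarrow> bool" where
  "is_phi_value M U f c \<longleftrightarrow>
     (\<exists>(\<alpha> :: nat \<Rightarrow> nat \<Rightarrow> real) (E :: nat \<Rightarrow> nat \<Rightarrow> 'a set).
        (\<forall>n i. E n i \<in> sets M) \<and>
        (\<lambda>n. Linf_norm M (\<lambda>x. f x - (\<Sum>i=1..n. \<alpha> n i * indicator (E n i) x))) \<longlonglongrightarrow> 0 \<and>
        (\<lambda>n. \<Sum>i=1..n. \<alpha> n i * delta_U U (E n i)) \<longlonglongrightarrow> c)"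

definition phi_U :: "'a measure \<Rightarrow> 'a set set \<Rightarrow> ('a \<Rightarrow> real) \<Rightarrow> real" where
  "phi_U M U f = (THE c. is_phi_value M U f c)"


text \<open>The description defining \<open>phi_U\<close> is proper on \<open>L\<^sup>\<infinity>\<close> when \<open>U\<close> is an ultrafilter.\<close>

lemma mu_filter_extend:
  assumes U: "mu_ultrafilter M U" and E: "E \<in> sets M"
    and pos: "\<And>S. S \<in> U \<Longrightarrow> emeasure M (S \<inter> E) > 0"
  shows "E \<in> U"
proof -
  have F: "mu_filter M U" and mx: "\<And>G. mu_filter M G \<Longrightarrow> U \<subseteq> G \<Longrightarrow> G = U"
    using U by (auto simp: mu_ultrafilter_def)
  define G where "G = {T \<in> sets M. \<exists>S\<in>U. S \<inter> E \<subseteq> T}"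
  have sub: "U \<subseteq> G" "E \<in> G" "G \<subseteq> sets M"
    using F E by (auto simp: G_def mu_filter_def)
  have "mu_filter M G"
    unfolding mu_filter_def
  proof (intro conjI ballI impI)
    show "G \<noteq> {}" "G \<subseteq> sets M" using sub by auto
    fix S assume "S \<in> G"
    then obtain S' where S': "S' \<in> U" "S' \<inter> E \<subseteq> S" "S \<in> sets M" by (auto simp: G_def)
    then have "emeasure M (S' \<inter> E) \<le> emeasure M S" by (intro emeasure_mono)
    then show "emeasure M S > 0" using pos[OF S'(1)] by simp
    show "S \<inter> T \<in> G" if "T \<in> G" for T
    proof -
      obtain T' where "T' \<in> U" "T' \<inter> E \<subseteq> T" "T \<in> sets M" using \<open>T \<in> G\<close> by (auto simp: G_def)
      moreover from this have "S' \<inter> T' \<in> U" using F S' by (auto simp: mu_filter_def)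
      ultimately show ?thesis using S' by (auto simp: G_def intro!: bexI[of _ "S' \<inter> T'"])
    qed
    show "T \<in> G" if "T \<in> sets M" "S \<subseteq> T" for T
      using that S' by (auto simp: G_def)
  qed
  then show ?thesis using mx sub by blast
qed

lemma mu_ultrafilter_dichotomy:
  assumes U: "mu_ultrafilter M U" and E: "E \<in> sets M"
  shows "E \<in> U \<or> space M - E \<in> U"
proof (cases "\<forall>S\<in>U. emeasure M (S \<inter> E) > 0")
  case True
  then show ?thesis using mu_filter_extend[OF U E] by auto
next
  case False
  then obtain S where S: "S \<in> U" "emeasure M (S \<inter> E) = 0" by auto
  have F: "mu_filter M U" using U by (auto simp: mu_ultrafilter_def)
  have "emeasure M (T \<inter> (space M - E)) > 0" if T: "T \<in> U" for T
  proof (rule ccontr)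
    assume "\<not> ?thesis"
    then have z: "emeasure M (T \<inter> (space M - E)) = 0" by simp
    have m: "S \<in> sets M" "T \<in> sets M" using S T F by (auto simp: mu_filter_def)
    have "S \<inter> E \<in> null_sets M" "T \<inter> (space M - E) \<in> null_sets M"
      using z S(2) m E by auto
    then have n: "(S \<inter> E) \<union> (T \<inter> (space M - E)) \<in> null_sets M" by auto
    have "S \<inter> T \<in> null_sets M"
      by (rule null_sets_subset[OF n]) (use m sets.sets_into_space[OF m(1)] in auto)
    moreover have "emeasure M (S \<inter> T) > 0" using F S T by (auto simp: mu_filter_def)
    ultimately show False by auto
  qed
  then show ?thesis using mu_filter_extend[OF U, of "space M - E"] E by auto
qed

lemma mu_ultrafilter_simple_const:
  fixes \<alpha> :: "nat \<Rightarrow> real"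
  assumes U: "mu_ultrafilter M U" and E: "\<And>i. E i \<in> sets M" and "finite I"
  shows "\<exists>S\<in>U. \<forall>x\<in>S. (\<Sum>i\<in>I. \<alpha> i * indicator (E i) x) = (\<Sum>i\<in>I. \<alpha> i * delta_U U (E i))"
  using \<open>finite I\<close>
proof (induction I)
  case empty
  have "U \<noteq> {}" using U by (auto simp: mu_ultrafilter_def mu_filter_def)
  then show ?case by auto
next
  case (insert j I)
  have F: "mu_filter M U" using U by (auto simp: mu_ultrafilter_def)
  obtain S where S: "S \<in> U"
    "\<And>x. x \<in> S \<Longrightarrow> (\<Sum>i\<in>I. \<alpha> i * indicator (E i) x) = (\<Sum>i\<in>I. \<alpha> i * delta_U U (E i))"
    using insert.IH by blast
  obtain T where T: "T \<in> U" "\<And>x. x \<in> T \<Longrightarrow> indicator (E j) x = delta_U U (E j)"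
  proof (cases "E j \<in> U")
    case True
    then show ?thesis by (intro that[of "E j"]) (auto simp: delta_U_def)
  next
    case False
    then have "space M - E j \<in> U" using mu_ultrafilter_dichotomy[OF U E[of j]] by auto
    then show ?thesis using False by (intro that[of "space M - E j"]) (auto simp: delta_U_def)
  qed
  have ST: "S \<inter> T \<in> U" using F S(1) T(1) by (auto simp: mu_filter_def)
  show ?case
  proof (intro bexI[OF _ ST] ballI)
    fix x assume "x \<in> S \<inter> T"
    then show "(\<Sum>i\<in>insert j I. \<alpha> i * indicator (E i) x) = (\<Sum>i\<in>insert j I. \<alpha> i * delta_U U (E i))"
      unfolding sum.insert[OF insert.hyps] using S(2)[of x] T(2)[of x] by (metis IntD1 IntD2)
  qed
qed

lemma mu_ultrafilter_simple_close:
  fixes \<alpha> \<beta> :: "nat \<Rightarrow> real"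
  assumes U: "mu_ultrafilter M U"
    and E: "\<And>i. E i \<in> sets M" and G: "\<And>i. G i \<in> sets M" and "finite I" "finite J"
    and f: "f \<in> borel_measurable M"
  shows "ereal \<bar>(\<Sum>i\<in>I. \<alpha> i * delta_U U (E i)) - (\<Sum>i\<in>J. \<beta> i * delta_U U (G i))\<bar>
    \<le> Linf_norm M (\<lambda>x. f x - (\<Sum>i\<in>I. \<alpha> i * indicator (E i) x))
      + Linf_norm M (\<lambda>x. f x - (\<Sum>i\<in>J. \<beta> i * indicator (G i) x))"
proof -
  let ?s = "\<lambda>x. (\<Sum>i\<in>I. \<alpha> i * indicator (E i) x) :: real"
  let ?t = "\<lambda>x. (\<Sum>i\<in>J. \<beta> i * indicator (G i) x) :: real"
  have F: "mu_filter M U" using U by (auto simp: mu_ultrafilter_def)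
  obtain S where S: "S \<in> U" "\<And>x. x \<in> S \<Longrightarrow> ?s x = (\<Sum>i\<in>I. \<alpha> i * delta_U U (E i))"
    using mu_ultrafilter_simple_const[where E = E and \<alpha> = \<alpha>, OF U E \<open>finite I\<close>] by blast
  obtain T where T: "T \<in> U" "\<And>x. x \<in> T \<Longrightarrow> ?t x = (\<Sum>i\<in>J. \<beta> i * delta_U U (G i))"
    using mu_ultrafilter_simple_const[where E = G and \<alpha> = \<beta>, OF U G \<open>finite J\<close>] by blast
  have ST: "S \<inter> T \<in> sets M" "emeasure M (S \<inter> T) > 0"
    using F S(1) T(1) by (auto simp: mu_filter_def)
  have ae: "AE x in M. ereal \<bar>f x - ?s x\<bar> \<le> Linf_norm M (\<lambda>x. f x - ?s x)
      \<and> ereal \<bar>f x - ?t x\<bar> \<le> Linf_norm M (\<lambda>x. f x - ?t x)" (is "AE x in M. ?P x")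
    unfolding Linf_norm_def by (intro AE_conjI esssup_AE)
  have "\<exists>x\<in>S \<inter> T. ?P x"
  proof (rule ccontr)
    assume "\<not> ?thesis"
    then have "?P x \<Longrightarrow> x \<notin> S \<inter> T" for x by blast
    with ae have "AE x in M. x \<notin> S \<inter> T" by (rule eventually_mono)
    then have "S \<inter> T \<in> null_sets M" using AE_iff_null_sets[OF ST(1)] by simp
    then show False using ST(2) by auto
  qed
  then obtain x where x: "x \<in> S" "x \<in> T" "?P x" by auto
  have "\<bar>?s x - ?t x\<bar> \<le> \<bar>f x - ?s x\<bar> + \<bar>f x - ?t x\<bar>" by linarith
  then have "ereal \<bar>?s x - ?t x\<bar> \<le> ereal \<bar>f x - ?s x\<bar> + ereal \<bar>f x - ?t x\<bar>" by simp
  also have "\<dots> \<le> Linf_norm M (\<lambda>x. f x - ?s x) + Linf_norm M (\<lambda>x. f x - ?t x)"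
    using x(3) by (intro add_mono) auto
  finally show ?thesis unfolding S(2)[OF x(1)] T(2)[OF x(2)] .
qed

lemma is_phi_value_unique:
  assumes U: "mu_ultrafilter M U" and f: "f \<in> Linf M"
    and c: "is_phi_value M U f c" and d: "is_phi_value M U f d"
  shows "c = d"
proof -
  have fm: "f \<in> borel_measurable M" using f by (simp add: Linf_def)
  obtain \<alpha> E where 1: "\<And>n i. E n i \<in> sets M"
    "(\<lambda>n. Linf_norm M (\<lambda>x. f x - (\<Sum>i=1..n. \<alpha> n i * indicator (E n i) x))) \<longlonglongrightarrow> 0"
    "(\<lambda>n. \<Sum>i=1..n. \<alpha> n i * delta_U U (E n i)) \<longlonglongrightarrow> c"
    using c unfolding is_phi_value_def by blast
  obtain \<beta> G where 2: "\<And>n i. G n i \<in> sets M"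
    "(\<lambda>n. Linf_norm M (\<lambda>x. f x - (\<Sum>i=1..n. \<beta> n i * indicator (G n i) x))) \<longlonglongrightarrow> 0"
    "(\<lambda>n. \<Sum>i=1..n. \<beta> n i * delta_U U (G n i)) \<longlonglongrightarrow> d"
    using d unfolding is_phi_value_def by blast
  let ?v = "\<lambda>n. \<Sum>i=1..n. \<alpha> n i * delta_U U (E n i)"
  let ?w = "\<lambda>n. \<Sum>i=1..n. \<beta> n i * delta_U U (G n i)"
  have "(\<lambda>n. ereal \<bar>?v n - ?w n\<bar>) \<longlonglongrightarrow> ereal \<bar>c - d\<bar>"
    using 1(3) 2(3) by (intro tendsto_intros)
  moreover have "(\<lambda>n. Linf_norm M (\<lambda>x. f x - (\<Sum>i=1..n. \<alpha> n i * indicator (E n i) x))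
      + Linf_norm M (\<lambda>x. f x - (\<Sum>i=1..n. \<beta> n i * indicator (G n i) x))) \<longlonglongrightarrow> 0 + 0"
    using 1(2) 2(2) by (intro tendsto_add_ereal) auto
  ultimately have "ereal \<bar>c - d\<bar> \<le> 0 + 0"
    by (rule LIMSEQ_le) (intro exI allI impI mu_ultrafilter_simple_close[OF U 1(1) 2(1) _ _ fm]; simp)
  then show ?thesis by simp
qed

lemma is_phi_value_exists:
  assumes U: "mu_ultrafilter M U" and f: "f \<in> Linf M"
  shows "\<exists>c. is_phi_value M U f c"
proof -
  have fm [measurable]: "f \<in> borel_measurable M" and fin: "Linf_norm M f < \<infinity>"
    using f by (auto simp: Linf_def)
  obtain r where r: "Linf_norm M f < ereal r" using less_PInf_Ex_of_nat fin by (metis ereal_dense2)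
  define K where "K = max r 1"
  have K: "K > 0" by (simp add: K_def)
  have "AE x in M. ereal \<bar>f x\<bar> \<le> Linf_norm M f" unfolding Linf_norm_def by (rule esssup_AE)
  then have bd: "AE x in M. \<bar>f x\<bar> < K"
  proof eventually_elim
    case (elim x)
    then have "ereal \<bar>f x\<bar> < ereal r" using r by order
    then show ?case by (simp add: K_def)
  qed
  define m where "m n x = \<lfloor>real n * (f x + K) / (2 * K)\<rfloor> + 1" for n x
  define E where "E n i = {x \<in> space M. m n x = int i}" for n i
  define \<alpha> where "\<alpha> n i = 2 * K * (real i - 1) / real n - K" for n i :: nat
  have E: "E n i \<in> sets M" for n i unfolding E_def m_def by measurable
  let ?s = "\<lambda>n x. (\<Sum>i=1..n. \<alpha> n i * indicator (E n i) x) :: real"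
  have approx: "\<bar>f x - ?s n x\<bar> \<le> 2 * K / real n" if x: "x \<in> space M" "\<bar>f x\<bar> < K" and n: "n > 0" for n x
  proof -
    let ?y = "real n * (f x + K) / (2 * K)"
    have "0 \<le> f x + K" "f x + K < 2 * K" using x by linarith+
    then have y: "0 \<le> ?y" "?y < real n" using K n by (auto simp: divide_less_eq)
    define k where "k = nat (m n x)"
    have k: "int k = m n x" using y unfolding k_def m_def by simp
    have k1: "k \<in> {1..n}" using y k unfolding m_def by (simp, linarith)
    have "?s n x = (\<Sum>i=1..n. if i = k then \<alpha> n i else 0)"
      using x(1) k by (intro sum.cong) (auto simp: E_def indicator_def)
    also have "\<dots> = \<alpha> n k" using k1 by simp
    finally have s: "?s n x = 2 * K * (real k - 1) / real n - K" by (simp add: \<alpha>_def)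
    have "real k - 1 = of_int \<lfloor>?y\<rfloor>" using k unfolding m_def by linarith
    then have "real k - 1 \<le> ?y" "?y < real k - 1 + 1" by linarith+
    moreover define h where "h = 2 * K / real n"
    have h: "h \<ge> 0" using K by (simp add: h_def)
    ultimately have "h * (real k - 1) \<le> h * ?y" "h * ?y \<le> h * (real k - 1 + 1)"
      by (intro mult_left_mono; simp)+
    moreover have "h * ?y = f x + K" using K n by (simp add: h_def)
    ultimately have "h * (real k - 1) \<le> f x + K" "f x + K \<le> h * (real k - 1) + h"
      by (simp_all only: distrib_left mult_1_right)
    moreover have "?s n x = h * (real k - 1) - K" unfolding s by (simp add: h_def)
    ultimately have "\<bar>f x - ?s n x\<bar> \<le> h" by (simp only: abs_le_iff) simp
    then show ?thesis by (simp only: h_def)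
  qed
  have err: "Linf_norm M (\<lambda>x. f x - ?s n x) \<le> ereal (2 * K / real n)" if n: "n > 0" for n
    unfolding Linf_norm_def
  proof (rule esssup_I)
    show "(\<lambda>x. ereal \<bar>f x - ?s n x\<bar>) \<in> borel_measurable M" using E by measurable
    show "AE x in M. ereal \<bar>f x - ?s n x\<bar> \<le> ereal (2 * K / real n)"
      using bd AE_space by eventually_elim (use approx n in auto)
  qed
  have nn: "0 \<le> Linf_norm M (\<lambda>x. f x - ?s n x)" for n
  proof -
    have "ereal 0 \<le> Linf_norm M (\<lambda>x. f x - ?s n x) + Linf_norm M (\<lambda>x. f x - ?s n x)"
      using mu_ultrafilter_simple_close[where E = "E n" and G = "E n" and I = "{1..n}" and J = "{1..n}"
          and \<alpha> = "\<alpha> n" and \<beta> = "\<alpha> n", OF U E E _ _ fm] by simp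
    then show ?thesis by (cases "Linf_norm M (\<lambda>x. f x - ?s n x)") auto
  qed
  have lim: "(\<lambda>n. 2 * K / real n) \<longlonglongrightarrow> 0" by (rule lim_const_over_n)
  have conv: "(\<lambda>n. Linf_norm M (\<lambda>x. f x - ?s n x)) \<longlonglongrightarrow> 0"
  proof (rule tendsto_sandwich[OF _ _ tendsto_const])
    show "(\<lambda>n. ereal (2 * K / real n)) \<longlonglongrightarrow> 0" using lim by (simp add: zero_ereal_def)
    show "\<forall>\<^sub>F n in sequentially. Linf_norm M (\<lambda>x. f x - ?s n x) \<le> ereal (2 * K / real n)"
      using eventually_gt_at_top[of 0] by eventually_elim (rule err)
  qed (use nn in auto)
  let ?v = "\<lambda>n. \<Sum>i=1..n. \<alpha> n i * delta_U U (E n i)"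
  have close: "\<bar>?v n - ?v k\<bar> \<le> 2 * K / real n + 2 * K / real k" if "n > 0" "k > 0" for n k
  proof -
    have "ereal \<bar>?v n - ?v k\<bar> \<le> ereal (2 * K / real n) + ereal (2 * K / real k)"
      using mu_ultrafilter_simple_close[where E = "E n" and G = "E k" and I = "{1..n}" and J = "{1..k}"
          and \<alpha> = "\<alpha> n" and \<beta> = "\<alpha> k", OF U E E _ _ fm]
      by (rule order_trans[OF _ add_mono[OF err[OF that(1)] err[OF that(2)]]]) auto
    then show ?thesis by simp
  qed
  have "Cauchy ?v"
  proof (rule metric_CauchyI)
    fix e :: real assume "e > 0"
    then have "\<forall>\<^sub>F n in sequentially. 2 * K / real n < e / 2" using lim by (intro order_tendstoD) auto
    then obtain N where N: "\<And>n. n \<ge> N \<Longrightarrow> 2 * K / real n < e / 2"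
      by (auto simp: eventually_sequentially)
    show "\<exists>N. \<forall>a\<ge>N. \<forall>b\<ge>N. dist (?v a) (?v b) < e"
    proof (intro exI[of _ "max N 1"] allI impI)
      fix a b assume "a \<ge> max N 1" "b \<ge> max N 1"
      then show "dist (?v a) (?v b) < e"
        using close[of a b] N[of a] N[of b] unfolding dist_real_def by force
    qed
  qed
  then obtain c where "?v \<longlonglongrightarrow> c" using Cauchy_convergent_iff convergent_def by blast
  then show ?thesis using E conv unfolding is_phi_value_def by blast
qed

lemma is_phi_value_phi_U:
  assumes "mu_ultrafilter M U" and "f \<in> Linf M"
  shows "is_phi_value M U f (phi_U M U f)"
proof -
  obtain c where c: "is_phi_value M U f c" using is_phi_value_exists[OF assms] by blast
  show ?thesis
    unfolding phi_U_def using c by (rule theI) (rule is_phi_value_unique[OF assms _ c])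
qed

end

theory Submission
  imports Defs
begin

text \<open>
  The pairs \<open>(f, A f)\<close> with \<open>f\<close> in the unit ball form a separable subset of \<open>L\<^sup>1 \<times> L\<^sup>1\<close>, even if \<open>A\<close>
  is unbounded. Given \<open>f\<close>, a value \<open>b \<in> [-1,1]\<close> and a set \<open>S\<close> of positive measure, take a chain
  \<open>(T\<^sub>t)\<close> of subsets of \<open>S\<close>, indexed by the reals and strictly increasing in measure, and put
  \<open>u\<^sub>t = (b - f) \<chi>(T\<^sub>t)\<close>. As the index set is uncountable, there are \<open>s < t\<close> such that
  \<open>u\<^sub>t - u\<^sub>s\<close> and \<open>A u\<^sub>t - A u\<^sub>s\<close> are both small in \<open>L\<^sup>1\<close>. Then \<open>g = f + u\<^sub>t - u\<^sub>s\<close> stays in the unit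
  ball, is close to \<open>f\<close> together with its image, and equals \<open>b\<close> on \<open>T\<^sub>t - T\<^sub>s \<subseteq> S\<close>. Doing this
  successively for countably many triples \<open>(f, \<epsilon>, b)\<close>, inside the set found before, gives a
  decreasing sequence of sets of positive measure, which generates the filter.
\<close>

section \<open>Almost everywhere bounds and the L^1 seminorm\<close>

lemma Linf_I:
  assumes "f \<in> borel_measurable M" "AE x in M. \<bar>f x\<bar> \<le> K"
  shows "f \<in> Linf M"
proof -
  have "Linf_norm M f \<le> ereal K"
    unfolding Linf_norm_def using assms by (intro esssup_I) auto
  then show ?thesis using assms(1) by (auto simp: Linf_def)
qed

lemma Linf_unit_ball_iff:
  "f \<in> Linf_unit_ball M \<longleftrightarrow> f \<in> borel_measurable M \<and> (AE x in M. \<bar>f x\<bar> \<le> 1)"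
proof
  assume f: "f \<in> Linf_unit_ball M"
  have "AE x in M. ereal \<bar>f x\<bar> \<le> Linf_norm M f"
    unfolding Linf_norm_def by (rule esssup_AE)
  then have "AE x in M. \<bar>f x\<bar> \<le> 1"
  proof eventually_elim
    case (elim x)
    also have "Linf_norm M f \<le> ereal 1" using f by (auto simp: Linf_unit_ball_def one_ereal_def)
    finally show ?case by simp
  qed
  then show "f \<in> borel_measurable M \<and> (AE x in M. \<bar>f x\<bar> \<le> 1)"
    using f by (auto simp: Linf_unit_ball_def Linf_def)
next
  assume f: "f \<in> borel_measurable M \<and> (AE x in M. \<bar>f x\<bar> \<le> 1)"
  have "Linf_norm M f \<le> 1"
    unfolding Linf_norm_def using f by (intro esssup_I) auto
  then show "f \<in> Linf_unit_ball M" using f Linf_I by (auto simp: Linf_unit_ball_def)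
qed

lemma Linf_unit_ball_subset: "Linf_unit_ball M \<subseteq> Linf M"
  by (auto simp: Linf_unit_ball_def)

lemma (in finite_measure) Linf_unit_ball_integrable:
  "f \<in> Linf_unit_ball M \<Longrightarrow> integrable M f"
  by (rule integrable_const_bound[of _ 1]) (auto simp: Linf_unit_ball_iff)

lemma L1_norm_minus_commute: "L1_norm M (\<lambda>x. f x - g x) = L1_norm M (\<lambda>x. g x - f x)"
  by (simp add: L1_norm_def abs_minus_commute)

lemma L1_norm_diff_triangle:
  assumes "integrable M f" "integrable M g" "integrable M h"
  shows "L1_norm M (\<lambda>x. f x - h x) \<le> L1_norm M (\<lambda>x. f x - g x) + L1_norm M (\<lambda>x. g x - h x)"
proof -
  have "L1_norm M (\<lambda>x. f x - h x) \<le> (LINT x|M. \<bar>f x - g x\<bar> + \<bar>g x - h x\<bar>)"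
    unfolding L1_norm_def using assms by (intro integral_mono) auto
  also have "\<dots> = L1_norm M (\<lambda>x. f x - g x) + L1_norm M (\<lambda>x. g x - h x)"
    unfolding L1_norm_def using assms by (intro Bochner_Integration.integral_add) auto
  finally show ?thesis .
qed

lemma L1_norm_cong_AE:
  assumes "AE x in M. f x = g x" "f \<in> borel_measurable M" "g \<in> borel_measurable M"
  shows "L1_norm M f = L1_norm M g"
  unfolding L1_norm_def using assms by (intro integral_cong_AE) auto

section \<open>Values of \<open>phi_U\<close> on functions constant on a member of the
  ultrafilter\<close>

text \<open>Each approximating simple function is constant on some \<open>T \<in> U\<close>, with
  value the n-th sum in the definition of \<open>phi_U\<close>. Since \<open>S \<inter> T\<close>
  has positive measure, the distance of this sum from \<open>b\<close> is bounded by the essential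
  supremum of the error, which tends to 0.\<close>

lemma phi_U_eqI:
  assumes U: "mu_ultrafilter M U" and g: "g \<in> Linf M"
    and S: "S \<in> U" "\<And>x. x \<in> S \<Longrightarrow> g x = b"
  shows "phi_U M U g = b"
proof -
  have F: "mu_filter M U" using U by (auto simp: mu_ultrafilter_def)
  have [measurable]: "g \<in> borel_measurable M" using g by (simp add: Linf_def)
  obtain \<alpha> E where 1: "\<And>n i. E n i \<in> sets M"
    "(\<lambda>n. Linf_norm M (\<lambda>x. g x - (\<Sum>i=1..n. \<alpha> n i * indicator (E n i) x))) \<longlonglongrightarrow> 0"
    "(\<lambda>n. \<Sum>i=1..n. \<alpha> n i * delta_U U (E n i)) \<longlonglongrightarrow> phi_U M U g"
    using is_phi_value_phi_U[OF U g] unfolding is_phi_value_def by blast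
  let ?s = "\<lambda>n x. (\<Sum>i=1..n. \<alpha> n i * indicator (E n i) x) :: real"
  let ?v = "\<lambda>n. \<Sum>i=1..n. \<alpha> n i * delta_U U (E n i)"
  have le: "ereal \<bar>b - ?v n\<bar> \<le> Linf_norm M (\<lambda>x. g x - ?s n x)" for n
  proof -
    obtain T where T: "T \<in> U" "\<And>x. x \<in> T \<Longrightarrow> ?s n x = ?v n"
      using mu_ultrafilter_simple_const[where E = "E n" and \<alpha> = "\<alpha> n" and I = "{1..n}", OF U 1(1)] by blast
    have ST: "S \<inter> T \<in> sets M" "emeasure M (S \<inter> T) > 0"
      using F S(1) T(1) by (auto simp: mu_filter_def)
    have ae: "AE x in M. ereal \<bar>g x - ?s n x\<bar> \<le> Linf_norm M (\<lambda>x. g x - ?s n x)"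
      unfolding Linf_norm_def by (rule esssup_AE)
    show ?thesis
    \<comment> \<open>If the bound failed, the almost everywhere estimate \<open>ae\<close> would
      fail at every point of \<open>S \<inter> T\<close>, making this set null.\<close>
    proof (rule ccontr)
      assume neg: "\<not> ?thesis"
      have "AE x in M. x \<notin> S \<inter> T"
        using ae
      proof eventually_elim
        case (elim x)
        show ?case
        proof
          assume "x \<in> S \<inter> T"
          then have "g x = b" "?s n x = ?v n" using S(2) T(2) by auto
          then show False using elim neg by simp
        qed
      qed
      then have "S \<inter> T \<in> null_sets M" using AE_iff_null_sets[OF ST(1)] by simp
      then show False using ST(2) by auto
    qed
  qed
  have "(\<lambda>n. ereal \<bar>b - ?v n\<bar>) \<longlonglongrightarrow> ereal \<bar>b - phi_U M U g\<bar>"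
    using 1(3) by (intro tendsto_intros)
  then have "ereal \<bar>b - phi_U M U g\<bar> \<le> 0"
    using 1(2) by (rule LIMSEQ_le) (use le in auto)
  then show ?thesis by simp
qed

section \<open>Separability of L^1 and of graphs in L^1 x L^1\<close>

text \<open>The dense set consists of the rational linear combinations of indicators of sets from a
  countable dense family. Density is shown for multiples of indicators and then carried over to sums
  and dominated limits.\<close>

lemma (in finite_measure) separable_measure_L1_dense:
  assumes "separable_measure M"
  obtains C :: "('a \<Rightarrow> real) set" where "countable C" "\<And>c. c \<in> C \<Longrightarrow> integrable M c"
    "\<And>f e. integrable M f \<Longrightarrow> e > 0 \<Longrightarrow> \<exists>c\<in>C. L1_norm M (\<lambda>x. f x - c x) < e"
proof -
  obtain D where D: "countable D" "D \<subseteq> sets M"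
    "\<And>S e. S \<in> sets M \<Longrightarrow> e > 0 \<Longrightarrow> \<exists>T\<in>D. measure M ((S - T) \<union> (T - S)) < e"
    using assms unfolding separable_measure_def by blast
  \<comment> \<open>Coding combinations by lists gives countability at once, and concatenation of
    lists is addition of functions.\<close>
  define comb :: "(real \<times> 'a set) list \<Rightarrow> 'a \<Rightarrow> real"
    where "comb l x = (\<Sum>(q, T)\<leftarrow>l. q * indicator T x)" for l x
  define C where "C = comb ` lists (\<rat> \<times> D)"
  have comb_int: "integrable M (comb l)" if "l \<in> lists (\<rat> \<times> D)" for l
    using that
  proof (induction l)
    case Nil
    have "comb [] = (\<lambda>x. 0)" by (auto simp: comb_def)
    then show ?case by simp
  next
    case (Cons p l)
    obtain q T where p: "p = (q, T)" by (cases p)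
    then have "T \<in> sets M" using Cons D(2) by auto
    then have "integrable M (\<lambda>x. q * indicator T x)"
      by (intro integrable_mult_right integrable_real_indicator) (auto simp: less_top[symmetric])
    moreover have "comb (p # l) = (\<lambda>x. q * indicator T x + comb l x)"
      by (auto simp: comb_def p)
    ultimately show ?case using Cons by auto
  qed
  have C_int: "integrable M c" if "c \<in> C" for c
    using that comb_int by (auto simp: C_def)
  have "countable C"
    unfolding C_def using D(1) by (intro countable_image countable_lists countable_SIGMA countable_rat) auto
  moreover have "\<forall>e>0. \<exists>c\<in>C. L1_norm M (\<lambda>x. f x - c x) < e" if "integrable M f" for f
    using that
  proof (induction rule: integrable_induct)
    case (base S r)
    show ?case
    proof (intro allI impI)
      fix e :: real assume e: "e > 0"
      \<comment> \<open>The budget \<open>e\<close> is halved between the error in the coefficient,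
        at most \<open>d\<close> on the whole space, and the error in the set. The tolerance for the
        set involves \<open>q\<close>, so \<open>q\<close> is chosen before \<open>T\<close>. Adding
        1 keeps both denominators positive.\<close>
      define d where "d = e / (2 * (measure M (space M) + 1))"
      have d: "d > 0" using e by (auto simp: d_def intro!: divide_pos_pos add_nonneg_pos)
      obtain q where q: "q \<in> \<rat>" "r - d < q" "q < r + d"
        using Rats_dense_in_real[of "r - d" "r + d"] d by auto
      obtain T where T: "T \<in> D" "measure M ((S - T) \<union> (T - S)) < e / (2 * (\<bar>q\<bar> + 1))"
        using D(3)[of S "e / (2 * (\<bar>q\<bar> + 1))"] base e by auto
      have [measurable]: "S \<in> sets M" "T \<in> sets M" using base T D(2) by auto
      have c: "(\<lambda>x. q * indicator T x) \<in> C"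
      proof -
        have "comb [(q, T)] \<in> C" using q(1) T(1) by (auto simp: C_def)
        moreover have "comb [(q, T)] = (\<lambda>x. q * indicator T x)" by (auto simp: comb_def)
        ultimately show ?thesis by simp
      qed
      let ?W = "(S - T) \<union> (T - S)"
      have "L1_norm M (\<lambda>x. indicator S x *\<^sub>R r - q * indicator T x)
          \<le> (LINT x|M. d + \<bar>q\<bar> * indicator ?W x)"
        unfolding L1_norm_def
      proof (rule integral_mono)
        show "integrable M (\<lambda>x. \<bar>indicator S x *\<^sub>R r - q * indicator T x\<bar>)"
          by (rule integrable_const_bound[of _ "\<bar>r\<bar> + \<bar>q\<bar>"]) (auto simp: indicator_def)
        show "integrable M (\<lambda>x. d + \<bar>q\<bar> * indicator ?W x)"
          by (rule integrable_const_bound[of _ "\<bar>d\<bar> + \<bar>q\<bar>"]) (auto simp: indicator_def)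
        \<comment> \<open>On \<open>S \<inter> T\<close> the left side is
          \<open>\<bar>r - q\<bar> < d\<close>. On \<open>?W\<close> it is
          \<open>\<bar>r\<bar>\<close> or \<open>\<bar>q\<bar>\<close>, both at most
          \<open>d + \<bar>q\<bar>\<close>.\<close>
        show "\<bar>indicator S x *\<^sub>R r - q * indicator T x\<bar> \<le> d + \<bar>q\<bar> * indicator ?W x" for x
          using q d by (auto simp: indicator_def)
      qed
      also have "\<dots> = d * measure M (space M) + \<bar>q\<bar> * measure M ?W"
        by (subst Bochner_Integration.integral_add) (auto simp: less_top[symmetric])
      also have "\<dots> < e / 2 + e / 2"
      proof (rule add_le_less_mono)
        have "d * measure M (space M) \<le> d * (measure M (space M) + 1)" using d by simp
        also have "\<dots> = e / 2"
          using measure_nonneg[of M "space M"] by (simp add: d_def field_simps add_nonneg_eq_0_iff)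
        finally show "d * measure M (space M) \<le> e / 2" .
        have "\<bar>q\<bar> * measure M ?W \<le> (\<bar>q\<bar> + 1) * measure M ?W" by (intro mult_right_mono) auto
        also have "\<dots> < (\<bar>q\<bar> + 1) * (e / (2 * (\<bar>q\<bar> + 1)))"
          using T(2) by (intro mult_strict_left_mono) auto
        also have "\<dots> = e / 2" by (simp add: divide_simps)
        finally show "\<bar>q\<bar> * measure M ?W < e / 2" .
      qed
      finally show "\<exists>c\<in>C. L1_norm M (\<lambda>x. indicator S x *\<^sub>R r - c x) < e"
        using c by auto
    qed
  next
    case (add f g)
    show ?case
    proof (intro allI impI)
      fix e :: real assume e: "e > 0"
      obtain c where c: "c \<in> C" "L1_norm M (\<lambda>x. f x - c x) < e / 2"
        using add e half_gt_zero by blast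
      obtain c' where c': "c' \<in> C" "L1_norm M (\<lambda>x. g x - c' x) < e / 2"
        using add e half_gt_zero by blast
      obtain l l' where l: "l \<in> lists (\<rat> \<times> D)" "l' \<in> lists (\<rat> \<times> D)" "c = comb l" "c' = comb l'"
        using c c' by (auto simp: C_def)
      have "comb (l @ l') = (\<lambda>x. c x + c' x)" using l by (auto simp: comb_def)
      moreover have "comb (l @ l') \<in> C" using l by (auto simp: C_def)
      ultimately have sum: "(\<lambda>x. c x + c' x) \<in> C" by simp
      have i: "integrable M f" "integrable M g" "integrable M c" "integrable M c'"
        using add c c' C_int by auto
      have "L1_norm M (\<lambda>x. f x + g x - (c x + c' x))
          \<le> L1_norm M (\<lambda>x. f x + g x - (c x + g x)) + L1_norm M (\<lambda>x. c x + g x - (c x + c' x))"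
        using i by (intro L1_norm_diff_triangle) auto
      also have "\<dots> < e" using c c' by (simp add: algebra_simps)
      finally show "\<exists>c\<in>C. L1_norm M (\<lambda>x. f x + g x - c x) < e"
        using sum by (rule bexI)
    qed
  next
    case (lim f s)
    have "(\<lambda>i. LINT x|M. \<bar>f x - s i x\<bar>) \<longlonglongrightarrow> (LINT x|M. 0)"
    \<comment> \<open>The induction rule supplies
      \<open>\<bar>s i x\<bar> \<le> 2 * \<bar>f x\<bar>\<close>, so the difference is dominated by
      \<open>3 * \<bar>f x\<bar>\<close>.\<close>
    proof (rule integral_dominated_convergence[where w = "\<lambda>x. 3 * \<bar>f x\<bar>"])
      show "AE x in M. (\<lambda>i. \<bar>f x - s i x\<bar>) \<longlonglongrightarrow> 0"
      proof (rule AE_I2)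
        fix x assume "x \<in> space M"
        then have "(\<lambda>i. s i x) \<longlonglongrightarrow> f x" using lim by auto
        then have "(\<lambda>i. \<bar>f x - s i x\<bar>) \<longlonglongrightarrow> \<bar>f x - f x\<bar>" by (intro tendsto_intros)
        then show "(\<lambda>i. \<bar>f x - s i x\<bar>) \<longlonglongrightarrow> 0" by simp
      qed
      show "AE x in M. norm \<bar>f x - s i x\<bar> \<le> 3 * \<bar>f x\<bar>" for i
      proof (rule AE_I2)
        fix x assume "x \<in> space M"
        then have "\<bar>s i x\<bar> \<le> 2 * \<bar>f x\<bar>" using lim by auto
        then show "norm \<bar>f x - s i x\<bar> \<le> 3 * \<bar>f x\<bar>" by simp
      qed
    qed (use lim in auto)
    then have conv: "(\<lambda>i. L1_norm M (\<lambda>x. f x - s i x)) \<longlonglongrightarrow> 0" by (simp add: L1_norm_def)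
    show ?case
    proof (intro allI impI)
      fix e :: real assume e: "e > 0"
      have "\<forall>\<^sub>F i in sequentially. L1_norm M (\<lambda>x. f x - s i x) < e / 2"
        using e by (intro order_tendstoD(2)[OF conv]) auto
      then obtain i where i: "L1_norm M (\<lambda>x. f x - s i x) < e / 2"
        by (auto simp: eventually_sequentially)
      obtain c where c: "c \<in> C" "L1_norm M (\<lambda>x. s i x - c x) < e / 2"
        using lim e half_gt_zero by blast
      have "L1_norm M (\<lambda>x. f x - c x) \<le> L1_norm M (\<lambda>x. f x - s i x) + L1_norm M (\<lambda>x. s i x - c x)"
        using lim c C_int by (intro L1_norm_diff_triangle) auto
      also have "\<dots> < e" using i c by simp
      finally show "\<exists>c\<in>C. L1_norm M (\<lambda>x. f x - c x) < e" using c by blast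
    qed
  qed
  ultimately show ?thesis using C_int that by blast
qed

text \<open>A subset of a separable metric space is separable; here the subset is the graph of
  \<open>A\<close> over \<open>B\<close>, inside L^1 x L^1. One point is picked from the graph in
  every nonempty box with centre in a countable dense set and radius
  \<open>1 / (k + 1)\<close>.\<close>

lemma (in finite_measure) separable_graph_dense:
  assumes sep: "separable_measure M" and B: "\<And>f. f \<in> B \<Longrightarrow> integrable M f \<and> integrable M (A f)"
  obtains D where "countable D" "D \<subseteq> B"
    "\<And>f e. f \<in> B \<Longrightarrow> e > 0 \<Longrightarrow>
      \<exists>g\<in>D. L1_norm M (\<lambda>x. f x - g x) < e \<and> L1_norm M (\<lambda>x. A f x - A g x) < e"
proof -
  obtain C :: "('a \<Rightarrow> real) set" where C: "countable C" "\<And>c. c \<in> C \<Longrightarrow> integrable M c"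
    "\<And>f e. integrable M f \<Longrightarrow> e > 0 \<Longrightarrow> \<exists>c\<in>C. L1_norm M (\<lambda>x. f x - c x) < e"
    using separable_measure_L1_dense[OF sep] by blast
  define P where "P p f \<longleftrightarrow> (case p of (c, c', k) \<Rightarrow>
    f \<in> B \<and> L1_norm M (\<lambda>x. f x - c x) < inverse (real (Suc k)) \<and>
    L1_norm M (\<lambda>x. A f x - c' x) < inverse (real (Suc k)))" for p f
  define I where "I = {p \<in> C \<times> C \<times> UNIV. \<exists>f. P p f}"
  define D where "D = (\<lambda>p. SOME f. P p f) ` I"
  have "countable I" unfolding I_def using C(1) by (intro countable_Collect countable_SIGMA) auto
  then have cD: "countable D" by (simp add: D_def)
  have some: "P p (SOME f. P p f)" if "p \<in> I" for p
  proof -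
    have "\<exists>f. P p f" using that unfolding I_def by blast
    then show ?thesis by (rule someI_ex)
  qed
  have "D \<subseteq> B"
  proof
    fix f assume "f \<in> D"
    then obtain p where "p \<in> I" "f = (SOME f. P p f)" by (auto simp: D_def)
    then have "P p f" using some by simp
    then show "f \<in> B" by (auto simp: P_def)
  qed
  moreover have "\<exists>g\<in>D. L1_norm M (\<lambda>x. f x - g x) < e \<and> L1_norm M (\<lambda>x. A f x - A g x) < e"
    if f: "f \<in> B" and e: "e > 0" for f e
  proof -
    obtain k where k: "inverse (real (Suc k)) < e / 2" using reals_Archimedean[of "e / 2"] e by auto
    obtain c where c: "c \<in> C" "L1_norm M (\<lambda>x. f x - c x) < inverse (real (Suc k))"
      using C(3)[of f "inverse (real (Suc k))"] B[OF f] by auto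
    obtain c' where c': "c' \<in> C" "L1_norm M (\<lambda>x. A f x - c' x) < inverse (real (Suc k))"
      using C(3)[of "A f" "inverse (real (Suc k))"] B[OF f] by auto
    \<comment> \<open>The pair of \<open>f\<close> and \<open>A f\<close> itself lies in this box,
      so the box contributed a point \<open>g\<close> to \<open>D\<close>. Sharing a box makes both
      distances from \<open>f\<close> to \<open>g\<close> less than
      \<open>2 / (k + 1) < e\<close>.\<close>
    have pI: "(c, c', k) \<in> I" using f c c' by (auto simp: I_def P_def)
    define g where "g = (SOME f. P (c, c', k) f)"
    have g: "P (c, c', k) g" "g \<in> D" using some[OF pI] pI by (auto simp: g_def D_def)
    then have gB: "g \<in> B" by (auto simp: P_def)
    have "L1_norm M (\<lambda>x. f x - g x) \<le> L1_norm M (\<lambda>x. f x - c x) + L1_norm M (\<lambda>x. c x - g x)"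
      using B[OF f] B[OF gB] C(2)[OF c(1)] by (intro L1_norm_diff_triangle) auto
    moreover have "L1_norm M (\<lambda>x. A f x - A g x)
        \<le> L1_norm M (\<lambda>x. A f x - c' x) + L1_norm M (\<lambda>x. c' x - A g x)"
      using B[OF f] B[OF gB] C(2)[OF c'(1)] by (intro L1_norm_diff_triangle) auto
    moreover have "L1_norm M (\<lambda>x. c x - g x) < inverse (real (Suc k))"
      "L1_norm M (\<lambda>x. c' x - A g x) < inverse (real (Suc k))"
      using g(1) L1_norm_minus_commute[of M c] L1_norm_minus_commute[of M c'] by (auto simp: P_def)
    ultimately show ?thesis using c c' k g(2) by (intro bexI[of _ g]) auto
  qed
  ultimately show ?thesis using that cD by blast
qed

text \<open>Pigeonhole principle: each index gets an approximant from a countable dense part of the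
  graph, within \<open>e / 2\<close>. Uncountably many indices share countably many approximants, so
  two distinct indices get the same one.\<close>

lemma (in finite_measure) uncountable_graph_close_pair:
  assumes sep: "separable_measure M"
    and u: "\<And>t. t \<in> I \<Longrightarrow> integrable M (u t) \<and> integrable M (A (u t))"
    and I: "uncountable I" and e: "e > 0"
  obtains s t where "s \<in> I" "t \<in> I" "s \<noteq> t" "L1_norm M (\<lambda>x. u t x - u s x) < e"
    "L1_norm M (\<lambda>x. A (u t) x - A (u s) x) < e"
proof -
  obtain D where D: "countable D" "D \<subseteq> u ` I"
    "\<And>f e. f \<in> u ` I \<Longrightarrow> e > 0 \<Longrightarrow>
      \<exists>g\<in>D. L1_norm M (\<lambda>x. f x - g x) < e \<and> L1_norm M (\<lambda>x. A f x - A g x) < e"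
    using separable_graph_dense[OF sep, of "u ` I" A] u by blast
  have "\<forall>t\<in>I. \<exists>g\<in>D. L1_norm M (\<lambda>x. u t x - g x) < e / 2 \<and> L1_norm M (\<lambda>x. A (u t) x - A g x) < e / 2"
    using D(3)[OF imageI half_gt_zero[OF e]] by blast
  then obtain c where c: "\<And>t. t \<in> I \<Longrightarrow> c t \<in> D"
    "\<And>t. t \<in> I \<Longrightarrow> L1_norm M (\<lambda>x. u t x - c t x) < e / 2"
    "\<And>t. t \<in> I \<Longrightarrow> L1_norm M (\<lambda>x. A (u t) x - A (c t) x) < e / 2"
    by metis
  have "countable (c ` I)" using c(1) by (intro countable_subset[OF _ D(1)]) auto
  then have "\<not> inj_on c I" using I countable_image_inj_on by blast
  then obtain s t where st: "s \<in> I" "t \<in> I" "s \<noteq> t" "c s = c t" by (auto simp: inj_on_def)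
  have i: "integrable M (c t)" "integrable M (A (c t))" using c(1)[OF st(2)] D(2) u by auto
  have "L1_norm M (\<lambda>x. u t x - u s x) \<le> L1_norm M (\<lambda>x. u t x - c t x) + L1_norm M (\<lambda>x. c t x - u s x)"
    using u st i by (intro L1_norm_diff_triangle) auto
  moreover have "L1_norm M (\<lambda>x. A (u t) x - A (u s) x)
      \<le> L1_norm M (\<lambda>x. A (u t) x - A (c t) x) + L1_norm M (\<lambda>x. A (c t) x - A (u s) x)"
    using u st i by (intro L1_norm_diff_triangle) auto
  ultimately show ?thesis
    using that[OF st(1-3)] c(2,3)[OF st(1)] c(2,3)[OF st(2)] st(4)
      L1_norm_minus_commute[of M "c t" "u s"] L1_norm_minus_commute[of M "A (c t)" "A (u s)"]
    by simp
qed

section \<open>Chains of sets in an atomless measure space\<close>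

text \<open>Splitting repeatedly yields disjoint pieces \<open>P n\<close> of positive measure in
  \<open>S\<close>. Labelling them by the rationals and letting \<open>T t\<close> collect the
  pieces with label below \<open>t\<close> turns the sequence into a chain over the reals: any
  rational strictly between \<open>s\<close> and \<open>t\<close> labels a piece in
  \<open>T t - T s\<close>.\<close>

lemma (in finite_measure) atomless_real_chain:
  assumes at: "atomless M" and S: "S \<in> sets M" "emeasure M S > 0"
  obtains T :: "real \<Rightarrow> 'a set" where "\<And>t. T t \<in> sets M" "\<And>t. T t \<subseteq> S" "mono T"
    "\<And>s t. s < t \<Longrightarrow> emeasure M (T t - T s) > 0"
proof -
  define pos where "pos Q \<longleftrightarrow> Q \<in> sets M \<and> Q \<subseteq> S \<and> emeasure M Q > 0" for Q
  have split: "\<exists>R. pos R \<and> R \<subseteq> Q \<and> emeasure M (Q - R) > 0" if Q: "pos Q" for Q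
  proof -
    obtain R where R: "R \<in> sets M" "R \<subseteq> Q" "emeasure M R \<noteq> 0" "emeasure M R \<noteq> emeasure M Q"
      using at Q unfolding atomless_def measure_atom_def pos_def by blast
    have "emeasure M (Q - R) = emeasure M Q - emeasure M R"
      using R Q by (intro emeasure_Diff) (auto simp: pos_def)
    moreover have "emeasure M R \<le> emeasure M Q" using R Q by (intro emeasure_mono) (auto simp: pos_def)
    ultimately have "emeasure M (Q - R) > 0"
      using R(4) by (metis diff_gr0_ennreal order.not_eq_order_implies_strict)
    then show ?thesis using R Q by (auto simp: pos_def zero_less_iff_neq_zero)
  qed
  have "\<exists>Q. pos Q" using S by (auto simp: pos_def)
  \<comment> \<open>Dependent choice always splits the retained set \<open>Q n\<close> again; the
    part removed from it becomes \<open>P n\<close>.\<close>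
  then have "\<exists>Q. \<forall>n. pos (Q n) \<and> (Q (Suc n) \<subseteq> Q n \<and> emeasure M (Q n - Q (Suc n)) > 0)"
    by (rule dependent_nat_choice[of "\<lambda>_. pos" "\<lambda>_ Q R. R \<subseteq> Q \<and> emeasure M (Q - R) > 0"]) (rule split)
  then obtain Q where Q: "\<And>n. pos (Q n)" "\<And>n. Q (Suc n) \<subseteq> Q n \<and> emeasure M (Q n - Q (Suc n)) > 0"
    by blast
  have "decseq Q" using Q(2) by (intro decseq_SucI) blast
  then have dec: "Q n \<subseteq> Q m" if "m \<le> n" for m n using that by (rule decseqD)
  define P where "P n = Q n - Q (Suc n)" for n
  have disj: "P m \<inter> P n = {}" if "m < n" for m n
    using dec[of "Suc m" n] that by (auto simp: P_def)
  then have disj: "P m \<inter> P n = {}" if "m \<noteq> n" for m n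
    using that by (metis inf_commute linorder_neqE_nat)
  define T where "T t = (\<Union>n\<in>{n. real_of_rat (nat_to_rat_surj n) < t}. P n)" for t
  have meas: "T t \<in> sets M" for t
    using Q(1) unfolding T_def P_def pos_def by (intro sets.countable_UN) auto
  moreover have "T t \<subseteq> S" for t using Q(1) by (fastforce simp: T_def P_def pos_def)
  moreover have "mono T" unfolding T_def by (intro monoI UN_mono) auto
  moreover have "emeasure M (T t - T s) > 0" if "s < t" for s t
  proof -
    obtain q where q: "s < real_of_rat q" "real_of_rat q < t" using of_rat_dense[OF \<open>s < t\<close>] by blast
    obtain n where n: "nat_to_rat_surj n = q" using surj_nat_to_rat_surj by (metis surjD)
    have "P n \<subseteq> T t" using q n by (auto simp: T_def)
    moreover have "P n \<inter> P m = {}" if "real_of_rat (nat_to_rat_surj m) < s" for m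
    proof (rule disj)
      show "n \<noteq> m" using that q n by auto
    qed
    then have "P n \<inter> T s = {}" by (auto simp: T_def)
    ultimately have "emeasure M (P n) \<le> emeasure M (T t - T s)"
      using meas by (intro emeasure_mono) auto
    then show ?thesis using Q(2)[of n] by (auto simp: P_def intro: less_le_trans)
  qed
  ultimately show ?thesis using that by blast
qed

section \<open>Perturbing a function to a constant on a small set\<close>

lemma (in finite_measure) perturb_to_constant:
  assumes at: "atomless M" and sep: "separable_measure M" and A: "linear_Linf_L1 M A"
    and f: "f \<in> Linf_unit_ball M" and b: "b \<in> {-1..1}" and e: "e > 0"
    and S: "S \<in> sets M" "emeasure M S > 0"
  obtains g W where "g \<in> Linf_unit_ball M" "L1_norm M (\<lambda>x. f x - g x) < e"
    "L1_norm M (\<lambda>x. A f x - A g x) < e" "W \<in> sets M" "emeasure M W > 0" "W \<subseteq> S"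
    "\<And>x. x \<in> W \<Longrightarrow> g x = b"
proof -
  obtain T :: "real \<Rightarrow> 'a set" where T: "\<And>t. T t \<in> sets M" "\<And>t. T t \<subseteq> S" "mono T"
    "\<And>s t. s < t \<Longrightarrow> emeasure M (T t - T s) > 0"
    using atomless_real_chain[OF at S] by blast
  note [measurable] = T(1)
  define u where "u t x = indicator (T t) x * (b - f x)" for t x
  have fm [measurable]: "f \<in> borel_measurable M" and f1: "AE x in M. \<bar>f x\<bar> \<le> 1"
    using f by (auto simp: Linf_unit_ball_iff)
  have A_int: "\<And>f. f \<in> Linf M \<Longrightarrow> integrable M (A f)"
    and A_add: "\<And>f g. f \<in> Linf M \<Longrightarrow> g \<in> Linf M \<Longrightarrow> AE x in M. A (\<lambda>y. f y + g y) x = A f x + A g x"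
    and A_scale: "\<And>c f. f \<in> Linf M \<Longrightarrow> AE x in M. A (\<lambda>y. c * f y) x = c * A f x"
    using A unfolding linear_Linf_L1_def by blast+
  have um [measurable]: "u t \<in> borel_measurable M" for t unfolding u_def by measurable
  \<comment> \<open>Both \<open>b\<close> and almost all values of \<open>f\<close> lie in [-1,1].
    Thus \<open>u t\<close> may leave the unit ball but stays in L^\<infinity>, where
    \<open>A\<close> is linear.\<close>
  have u2: "AE x in M. \<bar>u t x\<bar> \<le> 2" for t
    using f1 by eventually_elim (use b in \<open>auto simp: u_def indicator_def\<close>)
  have uL: "u t \<in> Linf M" for t using um u2 by (rule Linf_I)
  have u_int: "integrable M (u t) \<and> integrable M (A (u t))" for t
    using u2[of t] A_int[OF uL] by (auto intro!: integrable_const_bound[of _ 2])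
  obtain s t where st: "s < t" "L1_norm M (\<lambda>x. u t x - u s x) < e"
    "L1_norm M (\<lambda>x. A (u t) x - A (u s) x) < e"
  \<comment> \<open>The pair found is merely distinct; both estimates are symmetric, so it can be
    swapped to get \<open>s < t\<close>.\<close>
  proof (rule uncountable_graph_close_pair[OF sep, of UNIV u A e, OF u_int uncountable_UNIV_real e])
    fix s t :: real
    assume "s \<noteq> t" "L1_norm M (\<lambda>x. u t x - u s x) < e" "L1_norm M (\<lambda>x. A (u t) x - A (u s) x) < e"
    then show thesis
      using that[of s t] that[of t s] L1_norm_minus_commute[of M "u t" "u s"]
        L1_norm_minus_commute[of M "A (u t)" "A (u s)"]
      by (cases s t rule: linorder_cases) auto
  qed
  have sub: "T s \<subseteq> T t" using T(3) st(1) by (auto dest: monoD[of T s t])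
  \<comment> \<open>The difference is written with the factor \<open>-1\<close> so that additivity
    and homogeneity of \<open>A\<close> apply literally.\<close>
  define g where "g x = f x + (u t x + (-1) * u s x)" for x
  have g_eq: "g x = (if x \<in> T t - T s then b else f x)" for x
    using sub by (auto simp: g_def u_def indicator_def)
  have gm [measurable]: "g \<in> borel_measurable M" unfolding g_def by measurable
  have gB: "g \<in> Linf_unit_ball M"
    unfolding Linf_unit_ball_iff
  proof
    show "AE x in M. \<bar>g x\<bar> \<le> 1" using f1 by eventually_elim (use b in \<open>auto simp: g_eq\<close>)
  qed (rule gm)
  have sL: "(\<lambda>x. (-1) * u s x) \<in> Linf M" using u2[of s] by (intro Linf_I[where K = 2]) auto
  have dL: "(\<lambda>x. u t x + (-1) * u s x) \<in> Linf M"
  proof (rule Linf_I)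
    show "AE x in M. \<bar>u t x + (-1) * u s x\<bar> \<le> 4" using u2[of s] u2[of t] by eventually_elim auto
  qed simp
  have fL: "f \<in> Linf M" and gL: "g \<in> Linf M" using f gB Linf_unit_ball_subset by auto
  have "AE x in M. A g x = A f x + A (\<lambda>x. u t x + (-1) * u s x) x"
    unfolding g_def by (rule A_add[OF fL dL])
  then have "AE x in M. A g x - A f x = A (u t) x - A (u s) x"
    using A_add[OF uL[of t] sL] A_scale[OF uL[of s], of "-1"] by eventually_elim simp
  then have "L1_norm M (\<lambda>x. A g x - A f x) = L1_norm M (\<lambda>x. A (u t) x - A (u s) x)"
    using A_int fL gL uL by (intro L1_norm_cong_AE) (auto intro!: borel_measurable_diff)
  then have 2: "L1_norm M (\<lambda>x. A f x - A g x) < e" using st(3) L1_norm_minus_commute by metis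
  have "L1_norm M (\<lambda>x. g x - f x) = L1_norm M (\<lambda>x. u t x - u s x)" by (simp add: g_def)
  then have 1: "L1_norm M (\<lambda>x. f x - g x) < e" using st(2) L1_norm_minus_commute by metis
  show ?thesis
    using that[OF gB 1 2, of "T t - T s"] T(1,2,4) st(1) by (auto simp: g_eq)
qed

section \<open>The filter generated by a decreasing sequence, and the countable construction\<close>

lemma mu_filter_generated:
  fixes S :: "nat \<Rightarrow> 'a set"
  assumes "\<And>n. S n \<in> sets M" "\<And>n. emeasure M (S n) > 0" "antimono S"
  shows "mu_filter M {T \<in> sets M. \<exists>n. S n \<subseteq> T}"
  unfolding mu_filter_def
proof (intro conjI ballI impI)
  show "{T \<in> sets M. \<exists>n. S n \<subseteq> T} \<noteq> {}" using assms(1) by auto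
  fix T assume T: "T \<in> {T \<in> sets M. \<exists>n. S n \<subseteq> T}"
  then obtain n where n: "S n \<subseteq> T" by auto
  then show "emeasure M T > 0" using T assms(2)[of n] emeasure_mono[OF n] by (auto intro: less_le_trans)
  fix T' assume T': "T' \<in> {T \<in> sets M. \<exists>n. S n \<subseteq> T}"
  then obtain n' where "S n' \<subseteq> T'" by auto
  then have "S (max n n') \<subseteq> T \<inter> T'"
    using n antimonoD[OF assms(3), of n "max n n'"] antimonoD[OF assms(3), of n' "max n n'"] by auto
  then show "T \<inter> T' \<in> {T \<in> sets M. \<exists>n. S n \<subseteq> T}" using T T' by auto
qed auto

theorem theorem4p6:
  fixes M :: "'a measure" and A :: "('a \<Rightarrow> real) \<Rightarrow> ('a \<Rightarrow> real)"
  assumes "finite_measure M" and "emeasure M (space M) > 0"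
    and "atomless M" and "separable_measure M"
    and "linear_Linf_L1 M A"
  shows "\<exists>F. mu_filter M F \<and>
    (\<forall>U. mu_ultrafilter M U \<and> F \<subseteq> U \<longrightarrow>
      (\<forall>f \<in> Linf_unit_ball M. \<forall>\<epsilon>>0. \<forall>a \<in> {-1..1}.
        \<exists>g \<in> Linf_unit_ball M.
          L1_norm M (\<lambda>x. f x - g x) < \<epsilon> \<and>
          L1_norm M (\<lambda>x. A f x - A g x) < \<epsilon> \<and>
          phi_U M U g \<in> {a - \<epsilon><..<a + \<epsilon>}))"
proof -
  interpret finite_measure M by fact
  let ?B = "Linf_unit_ball M"
  let ?close = "\<lambda>f g e. L1_norm M (\<lambda>x. f x - g x) < e \<and> L1_norm M (\<lambda>x. A f x - A g x) < e"
  have int: "integrable M f \<and> integrable M (A f)" if "f \<in> ?B" for f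
    using that Linf_unit_ball_integrable[OF that] Linf_unit_ball_subset[of M] assms(5)
    by (auto simp: linear_Linf_L1_def)
  obtain D where D: "countable D" "D \<subseteq> ?B" "\<And>f e. f \<in> ?B \<Longrightarrow> e > 0 \<Longrightarrow> \<exists>g\<in>D. ?close f g e"
    using separable_graph_dense[OF assms(4) int, of "?B"] by blast
  \<comment> \<open>A triple holds a function from the dense set, an index \<open>m\<close> for the
    tolerance \<open>1 / (m + 1)\<close>, and a rational target value in [-1,1].\<close>
  define K where "K = D \<times> (UNIV :: nat set) \<times> (\<rat> \<inter> {-1..1::real})"
  have K: "countable K" unfolding K_def using D(1) countable_rat by (intro countable_SIGMA) auto
  \<comment> \<open>Nonemptiness of \<open>K\<close> ensures that \<open>from_nat_into K\<close>
    takes its values in \<open>K\<close>.\<close>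
  have "(\<lambda>x. 0) \<in> ?B" by (simp add: Linf_unit_ball_iff)
  then have "D \<noteq> {}" using D(3)[of _ 1] by force
  then have "K \<noteq> {}" unfolding K_def by (auto intro!: exI[of _ 0])
  define k where "k = from_nat_into K"
  define good where "good p W \<longleftrightarrow> (case p of (f, m, b) \<Rightarrow>
    \<exists>g\<in>?B. ?close f g (inverse (real (Suc m))) \<and> (\<forall>x\<in>W. g x = b))" for p W
  define pos where "pos W \<longleftrightarrow> W \<in> sets M \<and> emeasure M W > 0" for W
  have step: "\<exists>W. pos W \<and> W \<subseteq> S \<and> good (k n) W" if "pos S" for S n
  proof -
    obtain f m b where kn: "k n = (f, m, b)" by (cases "k n")
    have "k n \<in> K" unfolding k_def using \<open>K \<noteq> {}\<close> by (rule from_nat_into)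
    then have fb: "f \<in> ?B" "b \<in> {-1..1}" using D(2) by (auto simp: kn K_def)
    have S: "inverse (real (Suc m)) > 0" "S \<in> sets M" "emeasure M S > 0" using that by (auto simp: pos_def)
    show ?thesis
    proof (rule perturb_to_constant[OF assms(3-5) fb S])
      fix g W
      assume "g \<in> ?B" "L1_norm M (\<lambda>x. f x - g x) < inverse (real (Suc m))"
        "L1_norm M (\<lambda>x. A f x - A g x) < inverse (real (Suc m))" "\<And>x. x \<in> W \<Longrightarrow> g x = b"
      then have "good (k n) W" unfolding good_def kn prod.case by blast
      moreover assume "W \<in> sets M" "emeasure M W > 0" "W \<subseteq> S"
      ultimately show ?thesis unfolding pos_def by blast
    qed
  qed
  have "\<exists>S. pos S" using assms(2) by (auto simp: pos_def)
  \<comment> \<open>The set \<open>S (Suc n)\<close> serves the triple \<open>k n\<close>. Shrinking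
    further preserves this, since the witness stays constant on subsets.\<close>
  then have "\<exists>S. \<forall>n. pos (S n) \<and> (S (Suc n) \<subseteq> S n \<and> good (k n) (S (Suc n)))"
    by (rule dependent_nat_choice[of "\<lambda>_. pos" "\<lambda>n S W. W \<subseteq> S \<and> good (k n) W"]) (rule step)
  then obtain S where S: "\<And>n. pos (S n)" "\<And>n. S (Suc n) \<subseteq> S n \<and> good (k n) (S (Suc n))"
    by blast
  define F where "F = {T \<in> sets M. \<exists>n. S n \<subseteq> T}"
  have "mu_filter M F"
    unfolding F_def using S by (intro mu_filter_generated antimono_iff_le_Suc[THEN iffD2]) (auto simp: pos_def)
  moreover have "\<exists>g\<in>?B. L1_norm M (\<lambda>x. f x - g x) < \<epsilon> \<and> L1_norm M (\<lambda>x. A f x - A g x) < \<epsilon> \<and>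
      phi_U M U g \<in> {a - \<epsilon><..<a + \<epsilon>}"
    if U: "mu_ultrafilter M U" "F \<subseteq> U" and f: "f \<in> ?B" and e: "\<epsilon> > 0" and a: "a \<in> {-1..1}"
    for U f \<epsilon> and a :: real
  proof -
    obtain m where m: "inverse (real (Suc m)) < \<epsilon> / 2" using reals_Archimedean[of "\<epsilon> / 2"] e by auto
    obtain h where h: "h \<in> D" "?close f h (\<epsilon> / 2)" using D(3)[OF f, of "\<epsilon> / 2"] e by auto
    \<comment> \<open>The target \<open>b\<close> must be rational, lie in [-1,1] and be within
      \<open>\<epsilon>\<close> of \<open>a\<close>. The open interval is nonempty even if
      \<open>a\<close> is an endpoint of [-1,1].\<close>
    have "max (-1) (a - \<epsilon>) < min 1 (a + \<epsilon>)" using a e by auto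
    then obtain b where b: "b \<in> \<rat>" "max (-1) (a - \<epsilon>) < b" "b < min 1 (a + \<epsilon>)"
      using Rats_dense_in_real by blast
    have "(h, m, b) \<in> K" using h b by (auto simp: K_def)
    then obtain n where n: "k n = (h, m, b)"
      unfolding k_def using from_nat_into_surj[OF K] by metis
    obtain g where g: "g \<in> ?B" "?close h g (inverse (real (Suc m)))" "\<And>x. x \<in> S (Suc n) \<Longrightarrow> g x = b"
      using S(2)[of n] unfolding n good_def by auto
    \<comment> \<open>The set on which \<open>g\<close> equals \<open>b\<close> is a member of
      \<open>F\<close>, hence of every ultrafilter \<open>U\<close> containing \<open>F\<close>.
      This forces \<open>phi_U M U g = b\<close>, while \<open>h\<close> links \<open>f\<close> to
      \<open>g\<close> at the cost of \<open>\<epsilon> / 2\<close> per step.\<close>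
    have "S (Suc n) \<in> U" using U(2) S(1) by (auto simp: F_def pos_def)
    then have "phi_U M U g = b"
      using phi_U_eqI[where g = g, OF U(1) _ _ g(3)] g(1) Linf_unit_ball_subset by blast
    moreover have hB: "h \<in> ?B" using h D(2) by auto
    have "L1_norm M (\<lambda>x. f x - g x) \<le> L1_norm M (\<lambda>x. f x - h x) + L1_norm M (\<lambda>x. h x - g x)"
      "L1_norm M (\<lambda>x. A f x - A g x) \<le> L1_norm M (\<lambda>x. A f x - A h x) + L1_norm M (\<lambda>x. A h x - A g x)"
      using int[OF f] int[OF hB] int[OF g(1)] by (intro L1_norm_diff_triangle; simp)+
    ultimately show ?thesis using g(1,2) h(2) m b by (intro bexI[of _ g]) auto
  qed
  ultimately show ?thesis by blast
qed

end
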